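(* Let $c>0$ and $a_0\neq0$. Let $I\subset\mathbb{R}$ be an open interval, let $D,A:I\to(0,\infty)$ be smooth, and consider on $\mathbb{R}^4\times I$, with coordinates $(X^0,X^1,X^2,X^3,X^4)$, the Lorentzian metric $$ds^2=D(X^4)(dX^0)^2-(dX^1)^2-(dX^2)^2-(dX^3)^2-A(X^4)(dX^4)^2 .$$ Let $V$ be the unit comoving vector field, $V^0=D(X^4)^{-1/2}$, $V^k=0$ for $k=1,2,3,4$ (so $V_0=D(X^4)^{1/2}$, $V_k=0$), and let $F_\mu=V^\nu\nabla_\nu V_\mu$. Suppose that $\Sigma_{\mu\nu}=\Omega_{\mu\nu}=0$ (so that $\nabla_\mu V_\nu=V_\mu F_\nu$) and $g_{\mu\nu}F^\mu F^\nu=-a_0^2/c^4$. Then $$A(X^4)=\frac{c^4}{4a_0^2D(X^4)^2}\left(\frac{dD(X^4)}{dX^4}\right)^2 ,$$ and, using the replacement $dy^4=A(X^4)^{1/2}dX^4$, $y^0=X^0$, $y^1=X^1$, $y^2=X^2$, $y^3=X^3$, the metric becomes $$ds^2=\exp\left(\frac{2a_0y^4}{c^2}\right)(dy^0)^2-(dy^1)^2-(dy^2)^2-(dy^3)^2-(dy^4)^2 .$$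
   Context: Here $\nabla$ is the Levi-Civita connection of the metric $g$, of signature $(+,-,-,-,-)$, and indices run over $0,1,2,3,4$. For a smooth vector field $V$ with $g_{\mu\nu}V^\mu V^\nu=1$ one sets $F_\mu=V^\nu\nabla_\nu V_\mu$ and $$\Sigma_{\mu\nu}=\nabla_{(\mu}V_{\nu)}-V_{(\mu}F_{\nu)},\qquad \Omega_{\mu\nu}=\nabla_{[\mu}V_{\nu]}-V_{[\mu}F_{\nu]},$$ where $T_{(\mu\nu)}=\tfrac12(T_{\mu\nu}+T_{\nu\mu})$ and $T_{[\mu\nu]}=\tfrac12(T_{\mu\nu}-T_{\nu\mu})$, so that $\nabla_\mu V_\nu=\Sigma_{\mu\nu}+\Omega_{\mu\nu}+V_\mu F_\nu$. The field $V$ is called a Born rigid vector field without rotation if $\Sigma_{\mu\nu}=0$ and $\Omega_{\mu\nu}=0$; the condition $g_{\mu\nu}F^\mu F^\nu=-a_0^2/c^4$ expresses constant acceleration.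
   Formalization: The replacement is proved as dy^4 = ε A^{1/2} dX^4, ε = ±1 with sgn D' = ε sgn a_0, and y^4's additive constant suitably chosen; with the positive root the claim fails if D' and a_0 have opposite signs (e.g. c = a_0 = 1, D = exp(-2X^4), A = 1). *)

theory Defs
  imports "HOL-Analysis.Analysis"
begin

primrec Ck_on :: "nat \<Rightarrow> 'a::real_normed_vector set \<Rightarrow> ('a \<Rightarrow> 'b::real_normed_vector) \<Rightarrow> bool" where
  "Ck_on 0 S f \<longleftrightarrow> continuous_on S f"
| "Ck_on (Suc k) S f \<longleftrightarrow> (\<forall>x\<in>S. f differentiable (at x)) \<and>
     (\<forall>v. Ck_on k S (\<lambda>x. frechet_derivative f (at x) v))"

text \<open>Meant for open \<open>S\<close> only.\<close>

definition smooth_on :: "'a::real_normed_vector set \<Rightarrow> ('a \<Rightarrow> 'b::real_normed_vector) \<Rightarrow> bool" where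
  "smooth_on S f \<longleftrightarrow> (\<forall>k. Ck_on k S f)"

definition smooth_diffeo_on :: "'a::real_normed_vector set \<Rightarrow> ('a \<Rightarrow> 'b::real_normed_vector) \<Rightarrow> bool" where
  "smooth_diffeo_on S f \<longleftrightarrow> smooth_on S f \<and> inj_on f S \<and> open (f ` S)
     \<and> smooth_on (f ` S) (the_inv_into S f)"

text \<open>A metric on an open subset of \<open>real^'n\<close> is given by its component matrix
  \<open>g X $ \<mu> $ \<nu>\<close>, a vector field by its contravariant and a one-form by its covariant components.\<close>

definition partial_deriv :: "'n::finite \<Rightarrow> (real^'n \<Rightarrow> real) \<Rightarrow> real^'n \<Rightarrow> real" where
  "partial_deriv \<mu> f X = frechet_derivative f (at X) (axis \<mu> 1)"

definition christoffel ::
  "(real^'n \<Rightarrow> real^'n^'n) \<Rightarrow> real^'n \<Rightarrow> 'n::finite \<Rightarrow> 'n \<Rightarrow> 'n \<Rightarrow> real" where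
  "christoffel g X l \<mu> \<nu> = (\<Sum>s\<in>UNIV. matrix_inv (g X) $ l $ s *
     (partial_deriv \<mu> (\<lambda>Y. g Y $ s $ \<nu>) X + partial_deriv \<nu> (\<lambda>Y. g Y $ s $ \<mu>) X
      - partial_deriv s (\<lambda>Y. g Y $ \<mu> $ \<nu>) X)) / 2"

definition lower :: "(real^'n \<Rightarrow> real^'n^'n) \<Rightarrow> (real^'n \<Rightarrow> real^'n) \<Rightarrow> real^'n::finite \<Rightarrow> real^'n" where
  "lower g V X = g X *v V X"

definition raise :: "(real^'n \<Rightarrow> real^'n^'n) \<Rightarrow> (real^'n \<Rightarrow> real^'n) \<Rightarrow> real^'n::finite \<Rightarrow> real^'n" where
  "raise g W X = matrix_inv (g X) *v W X"

definition metric_prod ::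
  "(real^'n \<Rightarrow> real^'n^'n) \<Rightarrow> (real^'n \<Rightarrow> real^'n) \<Rightarrow> (real^'n \<Rightarrow> real^'n) \<Rightarrow> real^'n::finite \<Rightarrow> real" where
  "metric_prod g V W X = (\<Sum>\<mu>\<in>UNIV. \<Sum>\<nu>\<in>UNIV. g X $ \<mu> $ \<nu> * V X $ \<mu> * W X $ \<nu>)"

text \<open>\<open>cov_deriv g W X \<mu> \<nu>\<close> is \<open>\<nabla>\<^sub>\<mu> W\<^sub>\<nu>\<close>: the first index is the direction of differentiation.\<close>

definition cov_deriv ::
  "(real^'n \<Rightarrow> real^'n^'n) \<Rightarrow> (real^'n \<Rightarrow> real^'n) \<Rightarrow> real^'n \<Rightarrow> 'n::finite \<Rightarrow> 'n \<Rightarrow> real" where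
  "cov_deriv g W X \<mu> \<nu> = partial_deriv \<mu> (\<lambda>Y. W Y $ \<nu>) X
     - (\<Sum>l\<in>UNIV. christoffel g X l \<mu> \<nu> * W X $ l)"

definition acceleration ::
  "(real^'n \<Rightarrow> real^'n^'n) \<Rightarrow> (real^'n \<Rightarrow> real^'n) \<Rightarrow> real^'n::finite \<Rightarrow> real^'n" where
  "acceleration g V X = (\<chi> \<mu>. \<Sum>\<nu>\<in>UNIV. V X $ \<nu> * cov_deriv g (lower g V) X \<nu> \<mu>)"

definition sym_part :: "('n \<Rightarrow> 'n \<Rightarrow> real) \<Rightarrow> 'n \<Rightarrow> 'n \<Rightarrow> real" where
  "sym_part T \<mu> \<nu> = (T \<mu> \<nu> + T \<nu> \<mu>) / 2"

definition alt_part :: "('n \<Rightarrow> 'n \<Rightarrow> real) \<Rightarrow> 'n \<Rightarrow> 'n \<Rightarrow> real" where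
  "alt_part T \<mu> \<nu> = (T \<mu> \<nu> - T \<nu> \<mu>) / 2"

definition shear ::
  "(real^'n \<Rightarrow> real^'n^'n) \<Rightarrow> (real^'n \<Rightarrow> real^'n) \<Rightarrow> real^'n \<Rightarrow> 'n::finite \<Rightarrow> 'n \<Rightarrow> real" where
  "shear g V X \<mu> \<nu> = sym_part (cov_deriv g (lower g V) X) \<mu> \<nu>
     - sym_part (\<lambda>\<alpha> \<beta>. lower g V X $ \<alpha> * acceleration g V X $ \<beta>) \<mu> \<nu>"

definition rotation ::
  "(real^'n \<Rightarrow> real^'n^'n) \<Rightarrow> (real^'n \<Rightarrow> real^'n) \<Rightarrow> real^'n \<Rightarrow> 'n::finite \<Rightarrow> 'n \<Rightarrow> real" where
  "rotation g V X \<mu> \<nu> = alt_part (cov_deriv g (lower g V) X) \<mu> \<nu>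
     - alt_part (\<lambda>\<alpha> \<beta>. lower g V X $ \<alpha> * acceleration g V X $ \<beta>) \<mu> \<nu>"

definition born_rigid_irrotational ::
  "(real^'n::finite) set \<Rightarrow> (real^'n \<Rightarrow> real^'n^'n) \<Rightarrow> (real^'n \<Rightarrow> real^'n) \<Rightarrow> bool" where
  "born_rigid_irrotational S g V \<longleftrightarrow>
     (\<forall>X\<in>S. \<forall>\<mu> \<nu>. shear g V X \<mu> \<nu> = 0 \<and> rotation g V X \<mu> \<nu> = 0)"

definition pullback_metric ::
  "(real^'n \<Rightarrow> real^'n) \<Rightarrow> (real^'n \<Rightarrow> real^'n^'n) \<Rightarrow> real^'n::finite \<Rightarrow> real^'n^'n" where
  "pullback_metric \<Phi> h X = (\<chi> \<mu> \<nu>. \<Sum>\<alpha>\<in>UNIV. \<Sum>\<beta>\<in>UNIV. h (\<Phi> X) $ \<alpha> $ \<beta> *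
     partial_deriv \<mu> (\<lambda>Y. \<Phi> Y $ \<alpha>) X * partial_deriv \<nu> (\<lambda>Y. \<Phi> Y $ \<beta>) X)"

text \<open>The type \<open>5\<close> consists of the indices 0, 1, 2, 3, 4 (and the numeral 5 denotes 0 in it).\<close>

definition slab :: "real set \<Rightarrow> (real^5) set" where
  "slab I = {X. X $ 4 \<in> I}"

definition warped_metric :: "(real \<Rightarrow> real) \<Rightarrow> (real \<Rightarrow> real) \<Rightarrow> real^5 \<Rightarrow> real^5^5" where
  "warped_metric D A X = (\<chi> \<mu> \<nu>. if \<mu> \<noteq> \<nu> then 0
     else if \<mu> = 0 then D (X $ 4)
     else if \<mu> = 4 then - A (X $ 4)
     else - 1)"

definition comoving_field :: "(real \<Rightarrow> real) \<Rightarrow> real^5 \<Rightarrow> real^5" where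
  "comoving_field D X = (\<chi> \<mu>. if \<mu> = 0 then 1 / sqrt (D (X $ 4)) else 0)"

definition replace_X4 :: "(real \<Rightarrow> real) \<Rightarrow> real^5 \<Rightarrow> real^5" where
  "replace_X4 y X = (\<chi> \<mu>. if \<mu> = 4 then y (X $ 4) else X $ \<mu>)"

end

(* The Christoffel symbols leave F_4 = - D' / (2 D) as the only component of the acceleration, so
   g(F, F) = - D'^2 / (4 D^2 A), and constancy of the acceleration is the formula for A. As A > 0, the
   derivative D' never vanishes, hence has constant sign on the interval, and
   eps * sqrt A = c^2 D' / (2 a0 D) has the explicit antiderivative y = c^2 / (2 a0) * ln D, for
   which exp (2 a0 y / c^2) = D. *)

theory Submission
  imports Defs
begin

section \<open>Calculus of \<open>C\<^sup>k\<close> maps\<close>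

lemma frechet_derivative_eqI: "(f has_derivative f') (at x) \<Longrightarrow> frechet_derivative f (at x) v = f' v"
  by (simp add: frechet_derivative_at[symmetric])

text \<open>A derivative at a point of an open set depends only on the values nearby, so maps that
  agree on \<open>S\<close> have the same Frechet derivatives there. The induction then repeats this
  for the directional derivatives.\<close>

lemma Ck_on_cong:
  assumes "open S" "\<And>x. x \<in> S \<Longrightarrow> f x = g x"
  shows "Ck_on k S f \<longleftrightarrow> Ck_on k S g"
  using assms(2)
proof (induction k arbitrary: f g)
  case 0
  then show ?case by (auto cong: continuous_on_cong)
next
  case (Suc k)
  have tr: "(f has_derivative d) (at x) \<longleftrightarrow> (g has_derivative d) (at x)" if "x \<in> S" for x d
    using has_derivative_transform_within_open[of f d x UNIV S g]
      has_derivative_transform_within_open[of g d x UNIV S f] assms(1) that Suc.prems by auto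
  have fr: "frechet_derivative f (at x) = frechet_derivative g (at x)" if "x \<in> S" for x
    unfolding frechet_derivative_def using tr[OF that] by simp
  have "f differentiable (at x) \<longleftrightarrow> g differentiable (at x)" if "x \<in> S" for x
    using tr[OF that] unfolding differentiable_def by simp
  moreover have "Ck_on k S (\<lambda>x. frechet_derivative f (at x) v)
      \<longleftrightarrow> Ck_on k S (\<lambda>x. frechet_derivative g (at x) v)" for v
    by (rule Suc.IH) (simp add: fr)
  ultimately show ?case by simp
qed

text \<open>Lets an explicit formula \<open>f'\<close> stand in for
  \<open>frechet_derivative\<close>, which is defined by choice; uniqueness of the derivative
  identifies the two on \<open>S\<close>.\<close>

lemma Ck_on_SucI:
  assumes "open S" "\<And>x. x \<in> S \<Longrightarrow> (f has_derivative f' x) (at x)"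
    and "\<And>v. Ck_on k S (\<lambda>x. f' x v)"
  shows "Ck_on (Suc k) S f"
proof -
  have "Ck_on k S (\<lambda>x. frechet_derivative f (at x) v)" for v
    using assms(3)[of v]
    by (subst Ck_on_cong[OF assms(1), of _ "\<lambda>x. f' x v"])
      (auto simp: frechet_derivative_eqI[OF assms(2)])
  then show ?thesis
    using assms(2) by (auto simp: differentiable_def)
qed

lemma Ck_on_Suc_has_derivative:
  "Ck_on (Suc k) S f \<Longrightarrow> x \<in> S \<Longrightarrow> (f has_derivative frechet_derivative f (at x)) (at x)"
  by (auto simp: frechet_derivative_works)

lemma Ck_on_Suc_imp_Ck_on: "Ck_on (Suc k) S f \<Longrightarrow> Ck_on k S f"
proof (induction k arbitrary: f)
  case 0
  then show ?case
    by (auto intro!: continuous_at_imp_continuous_on differentiable_imp_continuous_within)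
next
  case (Suc k)
  then show ?case by (metis Ck_on.simps(2))
qed

lemma Ck_on_const: "Ck_on k S (\<lambda>x. c)"
proof (induction k arbitrary: c)
  case (Suc k)
  then show ?case by simp
qed simp

lemma Ck_on_bounded_linear:
  assumes "bounded_linear L" "open S"
  shows "Ck_on k S L"
proof (cases k)
  case 0
  then show ?thesis using assms by (simp add: linear_continuous_on)
next
  case (Suc m)
  show ?thesis
    unfolding Suc
    by (rule Ck_on_SucI[OF assms(2), where f' = "\<lambda>_. L"])
      (auto intro: Ck_on_const bounded_linear_imp_has_derivative assms)
qed

lemma Ck_on_add:
  assumes "open S"
  shows "Ck_on k S f \<Longrightarrow> Ck_on k S g \<Longrightarrow> Ck_on k S (\<lambda>x. f x + g x)"
proof (induction k arbitrary: f g)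
  case 0
  then show ?case by (simp add: continuous_on_add)
next
  case (Suc k)
  show ?case
    by (rule Ck_on_SucI[OF assms], rule has_derivative_add
        [OF Ck_on_Suc_has_derivative[OF Suc.prems(1)] Ck_on_Suc_has_derivative[OF Suc.prems(2)]])
      (use Suc in auto)
qed

text \<open>The product rule expresses the derivative as a sum of two products, each with one
  undifferentiated factor. That factor enters the induction hypothesis with its order lowered by
  one. Both multiplication and scaling are instances.\<close>

lemma (in bounded_bilinear) Ck_on:
  assumes "open S"
  shows "Ck_on k S f \<Longrightarrow> Ck_on k S g \<Longrightarrow> Ck_on k S (\<lambda>x. prod (f x) (g x))"
proof (induction k arbitrary: f g)
  case 0
  then show ?case by (simp add: continuous_on)
next
  case (Suc k)
  note lower_order = Suc.prems[THEN Ck_on_Suc_imp_Ck_on]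
  show ?case
    by (rule Ck_on_SucI[OF assms], rule FDERIV
        [OF Ck_on_Suc_has_derivative[OF Suc.prems(1)] Ck_on_Suc_has_derivative[OF Suc.prems(2)]])
      (use Suc lower_order in \<open>auto intro!: Ck_on_add[OF assms]\<close>)
qed

lemma Ck_on_inverse:
  fixes f :: "'a::real_normed_vector \<Rightarrow> real"
  assumes "open S" "\<And>x. x \<in> S \<Longrightarrow> f x \<noteq> 0"
  shows "Ck_on k S f \<Longrightarrow> Ck_on k S (\<lambda>x. inverse (f x))"
proof (induction k)
  case 0
  then show ?case using assms by (auto intro: continuous_on_inverse)
next
  case (Suc k)
  note IH = Suc.IH[OF Ck_on_Suc_imp_Ck_on[OF Suc.prems]]
  show ?case
  proof (rule Ck_on_SucI[OF assms(1)])
    \<comment> \<open>The derivative contains \<open>inverse (f x)\<close> again, but only to order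
      \<open>k\<close>, which the induction hypothesis covers. The sign is written as the factor
      \<open>- 1\<close> so that the whole is a product of \<open>Ck_on\<close> maps.\<close>
    show "((\<lambda>x. inverse (f x)) has_derivative
        (\<lambda>v. - 1 * (inverse (f x) * (frechet_derivative f (at x) v * inverse (f x))))) (at x)"
      if "x \<in> S" for x
      using Deriv.has_derivative_inverse[OF assms(2)[OF that] Ck_on_Suc_has_derivative[OF Suc.prems that]]
      by (simp add: mult.assoc)
    show "Ck_on k S (\<lambda>x. - 1 * (inverse (f x) * (frechet_derivative f (at x) v * inverse (f x))))" for v
      using IH Suc.prems
      by (intro bounded_bilinear.Ck_on[OF bounded_bilinear_mult assms(1)] Ck_on_const) auto
  qed
qed

text \<open>A linear map on the reals is determined by its value at 1, so the chain rule gives a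
  product of two separate factors. The induction hypothesis handles the first derivative of
  \<open>f\<close> composed with the same \<open>g\<close>.\<close>

lemma Ck_on_compose_real:
  fixes g :: "'a::real_normed_vector \<Rightarrow> real" and f :: "real \<Rightarrow> 'b::real_normed_vector"
  assumes "open S" "g ` S \<subseteq> T"
  shows "Ck_on k T f \<Longrightarrow> Ck_on k S g \<Longrightarrow> Ck_on k S (\<lambda>x. f (g x))"
proof (induction k arbitrary: f)
  case 0
  then show ?case using assms(2) by (auto intro: continuous_on_compose2)
next
  case (Suc k)
  show ?case
  proof (rule Ck_on_SucI[OF assms(1)])
    fix x assume x: "x \<in> S"
    let ?f' = "frechet_derivative f (at (g x))" and ?g' = "frechet_derivative g (at x)"
    have f': "(f has_derivative ?f') (at (g x))"
      using Ck_on_Suc_has_derivative[OF Suc.prems(1)] assms(2) x by blast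
    have "?f' (?g' v) = ?g' v *\<^sub>R ?f' 1" for v
      using linear_scale[OF has_derivative_linear[OF f'], of "?g' v" 1] by simp
    with has_derivative_compose[OF Ck_on_Suc_has_derivative[OF Suc.prems(2) x] f']
    show "((\<lambda>x. f (g x)) has_derivative (\<lambda>v. ?g' v *\<^sub>R ?f' 1)) (at x)"
      by simp
  next
    fix v
    show "Ck_on k S (\<lambda>x. frechet_derivative g (at x) v *\<^sub>R frechet_derivative f (at (g x)) 1)"
      using Suc Ck_on_Suc_imp_Ck_on[OF Suc.prems(2)]
      by (intro bounded_bilinear.Ck_on[OF bounded_bilinear_scaleR assms(1)]) auto
  qed
qed

section \<open>Smooth functions of one real variable and their inverses\<close>

lemma smooth_on_has_real_derivative:
  fixes f :: "real \<Rightarrow> real"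
  assumes "smooth_on S f" "x \<in> S"
  shows "(f has_real_derivative deriv f x) (at x)"
proof -
  have "Ck_on (Suc 0) S f" using assms by (auto simp: smooth_on_def)
  then have "f differentiable (at x)" using assms(2) by simp
  then show ?thesis
    by (metis DERIV_imp_deriv real_differentiableE)
qed

lemma smooth_on_deriv:
  fixes f :: "real \<Rightarrow> real"
  assumes "open S" "smooth_on S f"
  shows "smooth_on S (deriv f)"
  unfolding smooth_on_def
proof
  fix k
  have "Ck_on (Suc k) S f" using assms(2) by (auto simp: smooth_on_def)
  then have "Ck_on k S (\<lambda>x. frechet_derivative f (at x) 1)" by simp
  moreover have "frechet_derivative f (at x) 1 = deriv f x" if "x \<in> S" for x
    using smooth_on_has_real_derivative[OF assms(2) that]
    by (simp add: frechet_derivative_eqI has_field_derivative_def)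
  ultimately show "Ck_on k S (deriv f)"
    using Ck_on_cong[OF assms(1), of "\<lambda>x. frechet_derivative f (at x) 1" "deriv f" k] by simp
qed

text \<open>The derivative in direction \<open>v\<close> is \<open>f' x * v\<close>, hence
  \<open>f\<close> has one order more than \<open>f'\<close>. This yields the smoothness of a
  logarithm from that of its derivative.\<close>

lemma smooth_on_real_antiderivative:
  fixes f f' :: "real \<Rightarrow> real"
  assumes "open S" "\<And>x. x \<in> S \<Longrightarrow> (f has_real_derivative f' x) (at x)" "smooth_on S f'"
  shows "smooth_on S f"
  unfolding smooth_on_def
proof
  fix k
  have "Ck_on (Suc k) S f"
  proof (rule Ck_on_SucI[OF assms(1)])
    show "(f has_derivative (\<lambda>v. f' x * v)) (at x)" if "x \<in> S" for x
      using assms(2)[OF that] by (simp add: has_field_derivative_def)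
    show "Ck_on k S (\<lambda>x. f' x * v)" for v
      using assms(3)
      by (intro bounded_bilinear.Ck_on[OF bounded_bilinear_mult assms(1)] Ck_on_const)
        (simp add: smooth_on_def)
  qed
  then show "Ck_on k S f" by (rule Ck_on_Suc_imp_Ck_on)
qed

text \<open>The inverse \<open>z\<close> satisfies z' = 1 / (f' o z), so a bound on the order of
  \<open>z\<close> improves by one each time it is inserted on the right. Openness of the image is
  invariance of domain.\<close>

lemma smooth_diffeo_on_real:
  fixes f :: "real \<Rightarrow> real"
  assumes S: "open S" and f: "smooth_on S f" and inj: "inj_on f S"
    and nz: "\<And>x. x \<in> S \<Longrightarrow> deriv f x \<noteq> 0"
  shows "smooth_diffeo_on S f"
proof -
  define z where "z = the_inv_into S f"
  have zf: "z (f x) = x" if "x \<in> S" for x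
    unfolding z_def using the_inv_into_f_f[OF inj that] .
  have cont: "continuous_on S f"
    using f Ck_on.simps(1) unfolding smooth_on_def by blast
  have J: "open (f ` S)"
    by (rule invariance_of_domain[OF cont S inj])
  have zS: "z ` f ` S \<subseteq> S" using zf by auto
  have z': "(z has_derivative (\<lambda>v. v * inverse (deriv f (z t)))) (at t)" if "t \<in> f ` S" for t
  proof -
    from that obtain x where x: "x \<in> S" "t = f x" by auto
    have "(z has_derivative (\<lambda>v. v * inverse (deriv f x))) (at (f x))"
    proof (rule has_derivative_inverse_strong[OF S x(1) cont])
      show "(f has_derivative (*) (deriv f x)) (at x)"
        using smooth_on_has_real_derivative[OF f x(1)] by (simp add: has_field_derivative_def)
    qed (use zf nz[OF x(1)] in auto)
    then show ?thesis using x zf by simp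
  qed
  have "Ck_on k (f ` S) z" for k
  proof (induction k)
    case 0
    show ?case
      using z' by (auto intro!: continuous_at_imp_continuous_on dest: has_derivative_continuous)
  next
    case (Suc k)
    have "Ck_on k S (deriv f)"
      using smooth_on_deriv[OF S f] by (simp add: smooth_on_def)
    then have "Ck_on k (f ` S) (\<lambda>t. deriv f (z t))"
      using Suc.IH by (rule Ck_on_compose_real[OF J zS])
    then have "Ck_on k (f ` S) (\<lambda>t. inverse (deriv f (z t)))"
      using zS nz by (intro Ck_on_inverse[OF J]) auto
    then have "Ck_on k (f ` S) (\<lambda>t. v * inverse (deriv f (z t)))" for v
      by (rule bounded_bilinear.Ck_on[OF bounded_bilinear_mult J Ck_on_const])
    with z' show ?case
      by (rule Ck_on_SucI[OF J])
  qed
  then show ?thesis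
    unfolding smooth_diffeo_on_def using f inj J by (simp add: smooth_on_def z_def)
qed

section \<open>The map \<open>replace_X4\<close>\<close>

lemma open_slab: "open I \<Longrightarrow> open (slab I)"
  unfolding slab_def
  using open_vimage[of I "\<lambda>X::real^5. X $ 4"] by (simp add: vimage_def continuous_intros)

lemma smooth_on_replace_X4:
  assumes "open I" "smooth_on I y"
  shows "smooth_on (slab I) (replace_X4 y)"
  unfolding smooth_on_def
proof
  fix k
  note S = open_slab[OF assms(1)]
  \<comment> \<open>The identity plus a correction along one axis: a sum of products to which the
    \<open>Ck_on\<close> rules apply directly.\<close>
  have eq: "replace_X4 y = (\<lambda>X. X + (y (X $ 4) + - 1 * X $ 4) *\<^sub>R axis 4 1)"
    by (auto simp: fun_eq_iff replace_X4_def vec_eq_iff axis_def)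
  have proj: "Ck_on k (slab I) (\<lambda>X. X $ 4)"
    by (rule Ck_on_bounded_linear[OF bounded_linear_vec_nth S])
  have "Ck_on k I y" using assms(2) by (simp add: smooth_on_def)
  then have "Ck_on k (slab I) (\<lambda>X. y (X $ 4))"
    using proj by (rule Ck_on_compose_real[OF S, rotated]) (auto simp: slab_def)
  then show "Ck_on k (slab I) (replace_X4 y)"
    unfolding eq using proj
    by (intro Ck_on_add[OF S] bounded_bilinear.Ck_on[OF bounded_bilinear_scaleR S]
        bounded_bilinear.Ck_on[OF bounded_bilinear_mult S] Ck_on_const
        Ck_on_bounded_linear[OF bounded_linear_ident S])
qed

lemma smooth_diffeo_on_replace_X4:
  assumes "open I" "smooth_diffeo_on I y"
  shows "smooth_diffeo_on (slab I) (replace_X4 y)"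
proof -
  define z where "z = the_inv_into I y"
  have y: "smooth_on I y" "inj_on y I" "open (y ` I)" "smooth_on (y ` I) z"
    using assms(2) by (simp_all add: smooth_diffeo_on_def z_def)
  have zy: "z (y x) = x" if "x \<in> I" for x
    unfolding z_def using the_inv_into_f_f[OF y(2) that] .
  have left: "replace_X4 z (replace_X4 y X) = X" if "X \<in> slab I" for X
    using that zy by (auto simp: replace_X4_def slab_def vec_eq_iff)
  have right: "replace_X4 y (replace_X4 z X) = X" "replace_X4 z X \<in> slab I"
    if "X \<in> slab (y ` I)" for X
    using that zy by (auto simp: replace_X4_def slab_def vec_eq_iff)
  have inj: "inj_on (replace_X4 y) (slab I)"
    by (rule inj_on_inverseI[where g = "replace_X4 z"]) (rule left)
  have "replace_X4 y X \<in> slab (y ` I)" if "X \<in> slab I" for X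
    using that by (simp add: replace_X4_def slab_def)
  then have im: "replace_X4 y ` slab I = slab (y ` I)"
    using right by (metis image_eqI image_subsetI subsetI subset_antisym)
  have S: "open (slab (y ` I))" by (rule open_slab[OF y(3)])
  \<comment> \<open>The two maps are compared only on the image; since it is open, this is enough to
    transfer smoothness.\<close>
  have "the_inv_into (slab I) (replace_X4 y) X = replace_X4 z X" if "X \<in> slab (y ` I)" for X
    using the_inv_into_f_f[OF inj right(2)[OF that]] right(1)[OF that] by simp
  then have "smooth_on (slab (y ` I)) (the_inv_into (slab I) (replace_X4 y))"
    using smooth_on_replace_X4[OF y(3,4)] Ck_on_cong[OF S] unfolding smooth_on_def by metis
  then show ?thesis
    unfolding smooth_diffeo_on_def im using smooth_on_replace_X4[OF assms(1) y(1)] inj S by simp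
qed

section \<open>Functions of one coordinate and the pullback of the metric\<close>

lemma partial_deriv_comp_nth:
  fixes X :: "real^'n"
  assumes "(h has_real_derivative h') (at (X $ i))"
  shows "partial_deriv \<mu> (\<lambda>Y. h (Y $ i)) X = (if \<mu> = i then h' else 0)"
proof -
  have "((\<lambda>Y. h (Y $ i)) has_derivative (\<lambda>v. h' * (v $ i))) (at X)"
    using has_derivative_compose[OF bounded_linear_imp_has_derivative[OF bounded_linear_vec_nth]
        assms[unfolded has_field_derivative_def]] .
  then show ?thesis
    by (simp add: partial_deriv_def frechet_derivative_eqI axis_def)
qed

text \<open>Serves two contractions: with the diagonal Jacobian of \<open>replace_X4\<close>, and
  with the acceleration, whose only component is the fourth.\<close>

lemma sum_sum_delta_mult:
  fixes h :: "'n::finite \<Rightarrow> 'n \<Rightarrow> real"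
  shows "(\<Sum>\<alpha>\<in>UNIV. \<Sum>\<beta>\<in>UNIV. h \<alpha> \<beta> * (if \<mu> = \<alpha> then s \<alpha> else 0) * (if \<nu> = \<beta> then s \<beta> else 0))
    = h \<mu> \<nu> * s \<mu> * s \<nu>"
  by (simp add: mult_delta_left mult_delta_right)

lemma pullback_warped_metric_replace_X4:
  assumes "(y has_real_derivative y') (at (X $ 4))"
  shows "pullback_metric (replace_X4 y) (warped_metric E (\<lambda>t. 1)) X
    = warped_metric (\<lambda>t. E (y t)) (\<lambda>t. y'\<^sup>2) X"
proof -
  have d: "partial_deriv \<mu> (\<lambda>Y. replace_X4 y Y $ \<alpha>) X
      = (if \<mu> = \<alpha> then if \<alpha> = 4 then y' else 1 else 0)" for \<mu> \<alpha>
    \<comment> \<open>The second instance, with the identity function, covers the coordinates that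
      are left unchanged.\<close>
    using partial_deriv_comp_nth[OF assms, of \<mu>]
      partial_deriv_comp_nth[of "\<lambda>t. t" 1 X \<alpha> \<mu>]
    by (cases "\<alpha> = 4") (simp_all add: replace_X4_def)
  let ?h = "warped_metric E (\<lambda>t. 1) (replace_X4 y X)" and ?s = "\<lambda>\<alpha>::5. if \<alpha> = 4 then y' else 1"
  have "pullback_metric (replace_X4 y) (warped_metric E (\<lambda>t. 1)) X $ \<mu> $ \<nu>
      = warped_metric (\<lambda>t. E (y t)) (\<lambda>t. y'\<^sup>2) X $ \<mu> $ \<nu>" for \<mu> \<nu>
  proof -
    have "pullback_metric (replace_X4 y) (warped_metric E (\<lambda>t. 1)) X $ \<mu> $ \<nu>
        = ?h $ \<mu> $ \<nu> * ?s \<mu> * ?s \<nu>"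
      unfolding pullback_metric_def d vec_lambda_beta by (rule sum_sum_delta_mult)
    also have "\<dots> = warped_metric (\<lambda>t. E (y t)) (\<lambda>t. y'\<^sup>2) X $ \<mu> $ \<nu>"
      by (simp add: warped_metric_def replace_X4_def power2_eq_square)
    finally show ?thesis .
  qed
  then show ?thesis by (simp add: vec_eq_iff)
qed

section \<open>The acceleration of the comoving field\<close>

text \<open>\<open>matrix_inv\<close> is a choice of two-sided inverse. The explicit diagonal
  inverse \<open>N\<close> shows that one exists, and inverses are unique.\<close>

lemma matrix_inv_diagonal:
  fixes M :: "real^'n^'n"
  assumes "\<And>i j. i \<noteq> j \<Longrightarrow> M $ i $ j = 0" "\<And>i. M $ i $ i \<noteq> 0"
  shows "matrix_inv M $ i $ j = (if i = j then inverse (M $ i $ i) else 0)"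
proof -
  define N :: "real^'n^'n" where "N = (\<chi> i j. if i = j then inverse (M $ i $ i) else 0)"
  have M: "M = (\<chi> i j. if i = j then M $ i $ i else 0)"
    using assms(1) by (simp add: vec_eq_iff)
  have "M ** N = mat 1" "N ** M = mat 1"
    using assms(2)
    by (subst M, simp add: N_def matrix_matrix_mult_def mat_def vec_eq_iff
        mult_delta_right mult_delta_left)+
  then have "matrix_inv M ** M = mat 1" and MN: "M ** N = mat 1"
    unfolding matrix_inv_def by (metis (mono_tags, lifting) someI_ex)+
  then have "matrix_inv M = N"
    by (metis matrix_mul_assoc matrix_mul_lid matrix_mul_rid)
  then show ?thesis by (simp add: N_def)
qed

lemma matrix_inv_warped_metric:
  assumes "D (X $ 4) \<noteq> 0" "A (X $ 4) \<noteq> 0"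
  shows "matrix_inv (warped_metric D A X) $ i $ j
    = (if i = j then inverse (warped_metric D A X $ i $ i) else 0)"
  by (rule matrix_inv_diagonal) (use assms in \<open>auto simp: warped_metric_def\<close>)

text \<open>The nonzero entry is the square root of \<open>D\<close> where \<open>D\<close> is
  positive. The unsimplified product is valid at every \<open>Y\<close>, so the equation can rewrite
  under a partial derivative.\<close>

lemma lower_comoving_field:
  "lower (warped_metric D A) (comoving_field D) Y $ \<nu>
    = (if \<nu> = 0 then D (Y $ 4) * (1 / sqrt (D (Y $ 4))) else 0)"
  by (simp add: lower_def matrix_vector_mult_def warped_metric_def comoving_field_def
      mult_delta_right mult_delta_left)

text \<open>Only the 0-component of V is nonzero and nothing depends on X^0, so F_\<mu> reduces to
  minus the Christoffel symbol with upper index 0 and lower indices 0, \<mu>.\<close>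

lemma acceleration_comoving_field:
  assumes D: "(D has_real_derivative D') (at (X $ 4))" and pos: "D (X $ 4) > 0" "A (X $ 4) > 0"
  shows "acceleration (warped_metric D A) (comoving_field D) X $ \<mu>
    = (if \<mu> = 4 then - D' / (2 * D (X $ 4)) else 0)"
proof -
  let ?g = "warped_metric D A" and ?d = "D (X $ 4)"
  have g00: "partial_deriv \<mu> (\<lambda>Y. ?g Y $ 0 $ 0) X = (if \<mu> = 4 then D' else 0)"
    using partial_deriv_comp_nth[OF D] by (simp add: warped_metric_def)
  have "christoffel ?g X 0 0 \<mu> = (\<Sum>s\<in>UNIV. if 0 = s then inverse (?g X $ 0 $ 0) *
     (partial_deriv 0 (\<lambda>Y. ?g Y $ s $ \<mu>) X + partial_deriv \<mu> (\<lambda>Y. ?g Y $ s $ 0) X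
      - partial_deriv s (\<lambda>Y. ?g Y $ 0 $ \<mu>) X) else 0) / 2"
    unfolding christoffel_def using pos
    by (intro arg_cong[where f = "\<lambda>t. t / 2"] sum.cong) (auto simp: matrix_inv_warped_metric)
  \<comment> \<open>At \<open>s = 0\<close> the first and third derivatives are the same and
    cancel.\<close>
  also have "\<dots> = inverse (?g X $ 0 $ 0) * partial_deriv \<mu> (\<lambda>Y. ?g Y $ 0 $ 0) X / 2"
    by simp
  also have "\<dots> = (if \<mu> = 4 then D' / (2 * ?d) else 0)"
    unfolding g00 by (simp add: warped_metric_def divide_simps)
  finally have Gamma: "christoffel ?g X 0 0 \<mu> = (if \<mu> = 4 then D' / (2 * ?d) else 0)" .
  \<comment> \<open>The value of \<open>h'\<close> is irrelevant: the derivative is taken along X^0,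
    and the function depends on X^4 alone.\<close>
  have "\<exists>h'. ((\<lambda>t. D t * (1 / sqrt (D t))) has_real_derivative h') (at (X $ 4))"
    using pos(1) by (intro exI) (auto intro!: derivative_eq_intros D)
  then obtain h' where h': "((\<lambda>t. D t * (1 / sqrt (D t))) has_real_derivative h') (at (X $ 4))" ..
  have "partial_deriv 0 (\<lambda>Y. lower ?g (comoving_field D) Y $ \<mu>) X = 0"
    using partial_deriv_comp_nth[OF h', of 0] partial_deriv_comp_nth[of "\<lambda>t. 0" 0 X 4 0]
    by (cases "\<mu> = 0") (simp_all add: lower_comoving_field)
  then have "cov_deriv ?g (lower ?g (comoving_field D)) X 0 \<mu>
      = - (christoffel ?g X 0 0 \<mu> * (?d * (1 / sqrt ?d)))"
    unfolding cov_deriv_def lower_comoving_field by (simp add: mult_delta_right)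
  moreover have "acceleration ?g (comoving_field D) X $ \<mu>
      = 1 / sqrt ?d * cov_deriv ?g (lower ?g (comoving_field D)) X 0 \<mu>"
    by (simp add: acceleration_def comoving_field_def mult_delta_left)
  moreover have "1 / sqrt ?d * - (t * (?d * (1 / sqrt ?d))) = - t" for t
    using pos(1) by simp
  ultimately have "acceleration ?g (comoving_field D) X $ \<mu> = - christoffel ?g X 0 0 \<mu>"
    by (simp only:)
  then show ?thesis
    by (simp add: Gamma)
qed

lemma metric_prod_raise_acceleration:
  assumes D: "(D has_real_derivative D') (at (X $ 4))" and pos: "D (X $ 4) > 0" "A (X $ 4) > 0"
  defines "F \<equiv> acceleration (warped_metric D A) (comoving_field D)"
  shows "metric_prod (warped_metric D A) (raise (warped_metric D A) F) (raise (warped_metric D A) F) X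
    = - (D'\<^sup>2 / (4 * (D (X $ 4))\<^sup>2 * A (X $ 4)))"
proof -
  let ?f = "- D' / (2 * D (X $ 4))"
  have F: "F X $ \<mu> = (if \<mu> = 4 then ?f else 0)" for \<mu>
    unfolding F_def using acceleration_comoving_field[of D D' X A] D pos by blast
  \<comment> \<open>The sign comes from the negative entry - 1 / A of the inverse metric. The
    condition is oriented as \<open>4 = \<mu>\<close> to match
    \<open>sum_sum_delta_mult\<close>.\<close>
  have r: "raise (warped_metric D A) F X $ \<mu> = (if 4 = \<mu> then - ?f / A (X $ 4) else 0)" for \<mu>
    using pos
    by (simp add: raise_def matrix_vector_mult_def F matrix_inv_warped_metric mult_delta_right)
      (simp add: warped_metric_def divide_simps)
  have "metric_prod (warped_metric D A) (raise (warped_metric D A) F) (raise (warped_metric D A) F) X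
      = warped_metric D A X $ 4 $ 4 * (- ?f / A (X $ 4)) * (- ?f / A (X $ 4))"
    unfolding metric_prod_def r by (rule sum_sum_delta_mult)
  also have "\<dots> = - (D'\<^sup>2 / (4 * (D (X $ 4))\<^sup>2 * A (X $ 4)))"
    using pos by (simp add: warped_metric_def field_simps power2_eq_square)
  finally show ?thesis .
qed

section \<open>Sign and injectivity of real functions on an interval\<close>

text \<open>Intermediate values: the image is an interval that misses 0.\<close>

lemma sgn_eq_on_interval:
  fixes f :: "real \<Rightarrow> real"
  assumes "is_interval I" "continuous_on I f" "\<And>x. x \<in> I \<Longrightarrow> f x \<noteq> 0" "x \<in> I" "z \<in> I"
  shows "sgn (f x) = sgn (f z)"
proof -
  have "is_interval (f ` I)"
    using assms(1,2) connected_continuous_image is_interval_connected_1 by blast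
  moreover have "0 \<notin> f ` I" using assms(3) by force
  ultimately have "\<not> (f x \<le> 0 \<and> 0 \<le> f z)" "\<not> (f z \<le> 0 \<and> 0 \<le> f x)"
    using assms(4,5) unfolding is_interval_1 by blast+
  then show ?thesis by (auto simp: sgn_if)
qed

text \<open>By the mean value theorem, two equal values would force a zero of the derivative between
  them.\<close>

lemma inj_on_interval_if_deriv_nonzero:
  fixes f :: "real \<Rightarrow> real"
  assumes "is_interval I" "\<And>x. x \<in> I \<Longrightarrow> (f has_real_derivative f' x) (at x)"
    "\<And>x. x \<in> I \<Longrightarrow> f' x \<noteq> 0"
  shows "inj_on f I"
proof (rule linorder_inj_onI)
  fix a b assume ab: "a < b" "a \<in> I" "b \<in> I"
  then have sub: "x \<in> I" if "a \<le> x" "x \<le> b" for x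
    using assms(1) that unfolding is_interval_1 by blast
  from MVT2[OF ab(1), of f f'] assms(2) sub obtain \<xi>
    where "a < \<xi>" "\<xi> < b" "f b - f a = (b - a) * f' \<xi>" by blast
  with assms(3)[OF sub[of \<xi>]] ab(1) show "f a \<noteq> f b" by auto
qed auto

theorem mainTheorem3:
  fixes c a0 :: real and I :: "real set" and D A :: "real \<Rightarrow> real"
  assumes c: "c > 0" and a0: "a0 \<noteq> 0"
    and I: "open I" "is_interval I"
    and D: "smooth_on I D" "\<forall>x\<in>I. D x > 0"
    and A: "smooth_on I A" "\<forall>x\<in>I. A x > 0"
    and rigid: "born_rigid_irrotational (slab I) (warped_metric D A) (comoving_field D)"
    and accel: "\<forall>X\<in>slab I.
      metric_prod (warped_metric D A)
        (raise (warped_metric D A) (acceleration (warped_metric D A) (comoving_field D)))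
        (raise (warped_metric D A) (acceleration (warped_metric D A) (comoving_field D))) X
      = - (a0\<^sup>2 / c ^ 4)"
  shows "(\<forall>x\<in>I. A x = c ^ 4 / (4 * a0\<^sup>2 * (D x)\<^sup>2) * (deriv D x)\<^sup>2) \<and>
    (\<exists>\<epsilon>\<in>{1, -1}. (\<forall>x\<in>I. sgn (deriv D x) = \<epsilon> * sgn a0) \<and>
      (\<exists>y :: real \<Rightarrow> real.
        (\<forall>x\<in>I. (y has_real_derivative \<epsilon> * sqrt (A x)) (at x)) \<and>
        smooth_diffeo_on (slab I) (replace_X4 y) \<and>
        (\<forall>X\<in>slab I.
          pullback_metric (replace_X4 y)
            (warped_metric (\<lambda>t. exp (2 * a0 * t / c\<^sup>2)) (\<lambda>t. 1)) X
          = warped_metric D A X)))"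
proof -
  note D' = smooth_on_has_real_derivative[OF D(1)]
  have A_eq: "A x = c ^ 4 / (4 * a0\<^sup>2 * (D x)\<^sup>2) * (deriv D x)\<^sup>2" if x: "x \<in> I" for x
  proof -
    \<comment> \<open>Any point over \<open>x\<close> would do, since the metric depends only on the
      fourth coordinate.\<close>
    define X :: "real^5" where "X = (\<chi> i. x)"
    have "X \<in> slab I" and [simp]: "X $ 4 = x" using x by (auto simp: X_def slab_def)
    then have "- ((deriv D x)\<^sup>2 / (4 * (D x)\<^sup>2 * A x)) = - (a0\<^sup>2 / c ^ 4)"
      using accel metric_prod_raise_acceleration[of D "deriv D x" X A] D'[OF x] D(2) A(2) x by simp
    then have "(deriv D x)\<^sup>2 * c ^ 4 = a0\<^sup>2 * (4 * (D x)\<^sup>2 * A x)"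
      using c D(2) A(2) x by (simp add: frac_eq_eq less_imp_neq[symmetric])
    then show ?thesis
      using a0 D(2) x by (simp add: nonzero_eq_divide_eq less_imp_neq[symmetric] ac_simps)
  qed
  \<comment> \<open>A zero of the derivative would make \<open>A x\<close> vanish by
    \<open>A_eq\<close>.\<close>
  have nz: "deriv D x \<noteq> 0" if "x \<in> I" for x
    using A_eq[OF that] A(2) that by force
  have cont: "continuous_on I (deriv D)"
    using smooth_on_deriv[OF I(1) D(1)] Ck_on.simps(1) unfolding smooth_on_def by blast
  have "\<exists>\<epsilon>\<in>{1, -1}. \<forall>x\<in>I. sgn (deriv D x) = \<epsilon> * sgn a0"
  proof (cases "I = {}")
    case False
    then obtain x0 where x0: "x0 \<in> I" by auto
    \<comment> \<open>The sign \<epsilon> is read off at one point; the second factor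
      \<open>sgn a0\<close> undoes the first, because \<open>a0\<close> is nonzero.\<close>
    have "\<forall>x\<in>I. sgn (deriv D x) = (sgn (deriv D x0) * sgn a0) * sgn a0"
      using sgn_eq_on_interval[OF I(2) cont nz _ x0] a0 by (auto simp: sgn_if)
    moreover have "sgn (deriv D x0) * sgn a0 \<in> {1, -1}"
      using a0 nz[OF x0] by (auto simp: sgn_if)
    ultimately show ?thesis by blast
  qed auto
  then obtain \<epsilon> where eps: "\<epsilon> \<in> {1, -1 :: real}" and sgn: "\<forall>x\<in>I. sgn (deriv D x) = \<epsilon> * sgn a0"
    by blast
  \<comment> \<open>The constant of integration is fixed by \<open>y = 0\<close> where
    \<open>D = 1\<close>. Any other choice would leave a constant factor between the exponential and
    \<open>D\<close>.\<close>
  define y where "y = (\<lambda>t. c\<^sup>2 / (2 * a0) * ln (D t))"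
  define y' where "y' = (\<lambda>t. c\<^sup>2 / (2 * a0) * (deriv D t * inverse (D t)))"
  have dy: "(y has_real_derivative y' x) (at x)" if "x \<in> I" for x
    unfolding y_def y'_def
    using D(2) a0 that by (auto intro!: derivative_eq_intros D' simp: divide_simps)
  \<comment> \<open>The formula for \<open>A\<close> is the square of \<open>y'\<close>, which
    leaves the sign open. As the exponential of \<open>y\<close> must equal \<open>D\<close>, the
    sign of \<open>y'\<close> is that of D' / a0; hence the factor \<epsilon>.\<close>
  have y'_eq: "y' x = \<epsilon> * sqrt (A x)" if x: "x \<in> I" for x
  proof -
    have "A x = (y' x)\<^sup>2"
      using A_eq[OF x] by (simp add: y'_def power_mult_distrib power_divide field_simps flip: power_mult)
    then have "sqrt (A x) = \<bar>y' x\<bar>" by simp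
    moreover have "sgn (y' x) = \<epsilon>"
      using sgn[rule_format, OF x] c a0 D(2) x by (simp add: y'_def sgn_mult sgn_divide)
    ultimately show ?thesis
      by (metis sgn_mult_abs)
  qed
  have y'_nz: "y' x \<noteq> 0" if "x \<in> I" for x
    using nz[OF that] D(2) that a0 c by (auto simp: y'_def)
  have "smooth_on I y'"
    unfolding smooth_on_def
  proof
    fix k
    have "Ck_on k I (deriv D)" "Ck_on k I D"
      using smooth_on_deriv[OF I(1) D(1)] D(1) by (simp_all add: smooth_on_def)
    moreover from this(2) have "Ck_on k I (\<lambda>t. inverse (D t))"
      using D(2) by (intro Ck_on_inverse[OF I(1)]) auto
    ultimately show "Ck_on k I y'"
      unfolding y'_def by (intro bounded_bilinear.Ck_on[OF bounded_bilinear_mult I(1)] Ck_on_const)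
  qed
  then have "smooth_on I y"
    using smooth_on_real_antiderivative[OF I(1) dy] by blast
  moreover have "inj_on y I"
    using I(2) dy y'_nz by (rule inj_on_interval_if_deriv_nonzero)
  moreover have "deriv y x \<noteq> 0" if "x \<in> I" for x
    using DERIV_imp_deriv[OF dy[OF that]] y'_nz[OF that] by simp
  ultimately have "smooth_diffeo_on I y"
    by (rule smooth_diffeo_on_real[OF I(1)])
  then have "smooth_diffeo_on (slab I) (replace_X4 y)"
    by (rule smooth_diffeo_on_replace_X4[OF I(1)])
  moreover have "\<forall>X\<in>slab I. pullback_metric (replace_X4 y)
      (warped_metric (\<lambda>t. exp (2 * a0 * t / c\<^sup>2)) (\<lambda>t. 1)) X = warped_metric D A X"
  proof
    fix X assume "X \<in> slab I"
    then have x: "X $ 4 \<in> I" by (simp add: slab_def)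
    \<comment> \<open>The pulled-back metric has only two nontrivial entries, the exponential along
      \<open>y\<close> and minus the square of \<open>y'\<close>; these are matched with
      \<open>D\<close> and \<open>A\<close>.\<close>
    have "exp (2 * a0 * y (X $ 4) / c\<^sup>2) = D (X $ 4)"
      using c a0 D(2) x by (simp add: y_def)
    moreover have "(y' (X $ 4))\<^sup>2 = A (X $ 4)"
      using y'_eq[OF x] eps A(2) x by (auto simp: power_mult_distrib)
    ultimately show "pullback_metric (replace_X4 y)
        (warped_metric (\<lambda>t. exp (2 * a0 * t / c\<^sup>2)) (\<lambda>t. 1)) X = warped_metric D A X"
      unfolding pullback_warped_metric_replace_X4[OF dy[OF x]]
      by (simp add: warped_metric_def vec_eq_iff)
  qed
  moreover have "\<forall>x\<in>I. (y has_real_derivative \<epsilon> * sqrt (A x)) (at x)"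
    using dy y'_eq by simp
  ultimately show ?thesis
    using A_eq eps sgn by blast
qed

end
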